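(* For the function ${}_pF_q[a_1,a_2,\dots,a_p;b_1,b_2,\dots,b_q;\beta x]$, the following integral holds: $$\int_{-\infty}^{\infty}e^{-\alpha x^2}\,{}_pF_q[a_1,\dots,a_p;b_1,\dots,b_q;\beta x]\,dx=\sqrt{\frac{\pi}{\alpha}}\;{}_{2p}F_{2q}\left[\frac{a_1}{2},\frac{a_1+1}{2},\dots,\frac{a_p}{2},\frac{a_p+1}{2};\frac{b_1}{2},\frac{b_1+1}{2},\dots,\frac{b_q}{2},\frac{b_q+1}{2};2^{2(p-q)}\left(\frac{\beta^2}{4\alpha}\right)\right],\qquad p\le q+1.$$
   Context: Here $a_1,\dots,a_p,b_1,\dots,b_q,\alpha,\beta$ are parameters, and $p$ and $q$ are the numbers of Pochhammer terms in the numerator and denominator, respectively. The Pochhammer symbol is $(d)_r=\Gamma(d+r)/\Gamma(d)$. The generalized hypergeometric function is defined by the series $${}_pF_q[a_1,\dots,a_p;b_1,\dots,b_q;x]=\sum_{r=0}^{\infty}\frac{(a_1)_r\cdots(a_p)_r}{(b_1)_r\cdots(b_q)_r}\,\frac{x^r}{r!}.$$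
   Formalization: Proved for Re α > 0 and no b_j a non-positive integer; for p = q+1 the series of pFq at βx is assumed to converge for all real x (it terminates or β = 0), since otherwise it diverges for |βx| > 1, e.g. 1F0[1;;x], and so does the right-hand series. *)

theory Defs
  imports "HOL-Analysis.Analysis"
begin

text \<open>
  The library function \<^const>\<open>pochhammer\<close> is the rising factorial; it agrees with
  $\Gamma(d + r) / \Gamma(d)$ whenever $d$ is not a pole of $\Gamma$ and extends that
  quotient continuously to the non-positive integers, where the series terminates.
\<close>

definition pFq_term :: "complex list \<Rightarrow> complex list \<Rightarrow> complex \<Rightarrow> nat \<Rightarrow> complex" where
  "pFq_term as bs x r =
     (\<Prod>a\<leftarrow>as. pochhammer a r) / (\<Prod>b\<leftarrow>bs. pochhammer b r) * (x ^ r / fact r)"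

text \<open>
  The value is meaningful only where the series converges; elsewhere \<^const>\<open>suminf\<close>
  returns an unspecified number.
\<close>

definition pFq :: "complex list \<Rightarrow> complex list \<Rightarrow> complex \<Rightarrow> complex" where
  "pFq as bs x = (\<Sum>r. pFq_term as bs x r)"

definition halved_params :: "complex list \<Rightarrow> complex list" where
  "halved_params cs = concat (map (\<lambda>c. [c / 2, (c + 1) / 2]) cs)"

lemma foldl_pochhammer_eq_prod_list:
  "foldl (\<lambda>r a. r * pochhammer a n) c as = c * (\<Prod>a\<leftarrow>as. pochhammer (a :: complex) n)"
  by (induction as arbitrary: c) (simp_all add: mult.assoc)

lemma pFq_eq_eval_fps_hypergeo: "pFq as bs x = eval_fps (fps_hypergeo as bs 1) x"
  unfolding pFq_def pFq_term_def eval_fps_def fps_hypergeo_def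
  by (simp add: foldl_pochhammer_eq_prod_list)

end

theory Submission
  imports Defs "HOL-Probability.Distributions" "HOL-Real_Asymp.Real_Asymp"
begin

text \<open>
  Integrate the series term by term against the Gaussian: odd moments vanish, and the even moments
  combine with the duplication formula for \<^const>\<open>pochhammer\<close> into the series with halved
  parameters. Term-by-term integration is dominated by a Gaussian times \<open>exp (D * \<bar>x\<bar>)\<close>,
  because the \<open>r\<close>-th coefficient is at most \<open>K * D ^ r / fact r\<close>. For \<open>p \<le> q\<close> this holds since
  the ratio of consecutive coefficients is \<open>O(1 / r)\<close>; for \<open>p = q + 1\<close> convergence on the whole
  real line forces the series to terminate.
\<close>

section \<open>Integrability, decay and recurrence of Gaussian moments\<close>

text \<open>With variance 1 / (2 a), the Gaussian is a constant multiple of a centred normal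
  density, so this is the existence of normal moments.\<close>

lemma integrable_power_times_gaussian_real:
  fixes a :: real
  assumes "a > 0"
  shows "integrable lborel (\<lambda>x. x ^ k * exp (- a * x\<^sup>2))"
proof -
  define \<sigma> where "\<sigma> = sqrt (1 / (2 * a))"
  have \<sigma>: "\<sigma> > 0" "\<sigma>\<^sup>2 = 1 / (2 * a)"
    using assms by (auto simp: \<sigma>_def)
  have "integrable lborel (\<lambda>x. sqrt (2 * pi * \<sigma>\<^sup>2) * (normal_density 0 \<sigma> x * (x - 0) ^ k))"
    using integrable_normal_moment[OF \<sigma>(1)] by (intro integrable_mult_right)
  moreover have "sqrt (2 * pi * \<sigma>\<^sup>2) * (normal_density 0 \<sigma> x * (x - 0) ^ k) = x ^ k * exp (- a * x\<^sup>2)" for x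
    using \<sigma> assms by (simp add: normal_density_def mult.commute)
  ultimately show ?thesis by (simp only:)
qed

text \<open>For real x the modulus of the complex Gaussian depends only on
  \<open>Re \<alpha>\<close>, so the real case dominates.\<close>

lemma integrable_power_times_gaussian:
  fixes \<alpha> :: complex
  assumes "Re \<alpha> > 0"
  shows "integrable lborel (\<lambda>x::real. of_real x ^ k * exp (- \<alpha> * (of_real x)\<^sup>2))"
proof (rule Bochner_Integration.integrable_bound[OF integrable_power_times_gaussian_real[OF assms]])
  show "AE x in lborel. norm (of_real x ^ k * exp (- \<alpha> * (of_real x)\<^sup>2)) \<le> norm (x ^ k * exp (- Re \<alpha> * x\<^sup>2))"
    by (simp add: norm_mult norm_power abs_mult power_abs Re_power2)
qed simp

lemma tendsto_power_times_gaussian: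
  fixes a :: real
  assumes "a > 0"
  shows "((\<lambda>x. x ^ k * exp (- a * x\<^sup>2)) \<longlongrightarrow> 0) at_top"
    and "((\<lambda>x. x ^ k * exp (- a * x\<^sup>2)) \<longlongrightarrow> 0) at_bot"
  using assms by real_asymp+

text \<open>Transfers the fundamental theorem for interval integrals with infinite endpoints to the
  Lebesgue integral over the line; it serves for integration by parts with boundary terms at
  infinity.\<close>

lemma integral_real_line_FTC:
  fixes F f :: "real \<Rightarrow> complex"
  assumes F: "\<And>x. (F has_vector_derivative f x) (at x)"
    and f: "\<And>x. isCont f x" and int: "integrable lborel f"
    and lim: "(F \<longlongrightarrow> A) at_bot" "(F \<longlongrightarrow> B) at_top"
  shows "(LINT x|lborel. f x) = B - A"
proof -
  have "(LBINT x=-\<infinity>..\<infinity>. f x) = B - A"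
  proof (rule interval_integral_FTC_integrable[OF _ F f])
    show "((F \<circ> real_of_ereal) \<longlongrightarrow> A) (at_right (-\<infinity>))" "((F \<circ> real_of_ereal) \<longlongrightarrow> B) (at_left \<infinity>)"
      using lim by (simp_all only: ereal_tendsto_simps)
  qed (use int in \<open>simp_all add: set_integrable_def\<close>)
  then show ?thesis
    by (simp add: interval_lebesgue_integral_def set_lebesgue_integral_def)
qed

lemma tendsto_power_times_gaussian_complex:
  fixes \<alpha> :: complex
  assumes "Re \<alpha> > 0"
  shows "((\<lambda>x::real. of_real x ^ k * exp (- \<alpha> * (of_real x)\<^sup>2)) \<longlongrightarrow> 0) at_top"
    and "((\<lambda>x::real. of_real x ^ k * exp (- \<alpha> * (of_real x)\<^sup>2)) \<longlongrightarrow> 0) at_bot"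
proof -
  have *: "norm (of_real x ^ k * exp (- \<alpha> * (of_real x)\<^sup>2)) = norm (x ^ k * exp (- Re \<alpha> * x\<^sup>2))" for x
    by (simp add: norm_mult norm_power abs_mult power_abs Re_power2)
  show "((\<lambda>x::real. of_real x ^ k * exp (- \<alpha> * (of_real x)\<^sup>2)) \<longlongrightarrow> 0) at_top"
    "((\<lambda>x::real. of_real x ^ k * exp (- \<alpha> * (of_real x)\<^sup>2)) \<longlongrightarrow> 0) at_bot"
    using tendsto_power_times_gaussian[OF assms, of k, THEN tendsto_norm]
    by (subst tendsto_norm_zero_iff[symmetric], simp only: *, simp)+
qed

text \<open>Integration by parts: the derivative of x^(k+1) times the Gaussian integrates to 0,
  because that product vanishes at both ends of the line.\<close>

lemma gaussian_moment_step:
  fixes \<alpha> :: complex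
  assumes "Re \<alpha> > 0"
  shows "2 * \<alpha> * (LINT x|lborel. of_real x ^ (k + 2) * exp (- \<alpha> * (of_real x)\<^sup>2))
    = of_nat (k + 1) * (LINT x|lborel. of_real x ^ k * exp (- \<alpha> * (of_real x)\<^sup>2))"
proof -
  let ?g = "\<lambda>k x. of_real x ^ k * exp (- \<alpha> * (of_real x)\<^sup>2)"
  note int = integrable_power_times_gaussian[OF assms]
  have "(LINT x|lborel. of_nat (k + 1) * ?g k x - 2 * \<alpha> * ?g (k + 2) x) = 0 - 0"
  proof (rule integral_real_line_FTC[where F = "?g (k + 1)"])
    show "(?g (k + 1) has_vector_derivative of_nat (k + 1) * ?g k x - 2 * \<alpha> * ?g (k + 2) x) (at x)" for x
    proof -
      have "((\<lambda>z. z ^ (k + 1) * exp (- \<alpha> * z\<^sup>2)) has_field_derivative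
              of_nat (k + 1) * ?g k x - 2 * \<alpha> * ?g (k + 2) x) (at (of_real x))"
        by (rule derivative_eq_intros refl)+ (simp add: algebra_simps power2_eq_square)
      from has_vector_derivative_real_field[OF this] show ?thesis .
    qed
    show "isCont (\<lambda>x. of_nat (k + 1) * ?g k x - 2 * \<alpha> * ?g (k + 2) x) x" for x
      by (intro continuous_intros)
    show "integrable lborel (\<lambda>x. of_nat (k + 1) * ?g k x - 2 * \<alpha> * ?g (k + 2) x)"
      using int by (intro Bochner_Integration.integrable_diff integrable_mult_right)
  qed (use tendsto_power_times_gaussian_complex[OF assms] in blast)+
  moreover have "(LINT x|lborel. of_nat (k + 1) * ?g k x - 2 * \<alpha> * ?g (k + 2) x) =
     of_nat (k + 1) * (LINT x|lborel. ?g k x) - 2 * \<alpha> * (LINT x|lborel. ?g (k + 2) x)"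
    unfolding Bochner_Integration.integral_diff[OF integrable_mult_right[OF int] integrable_mult_right[OF int]]
    by (simp only: integral_mult_right_zero)
  ultimately show ?thesis by (simp del: power_add)
qed

text \<open>The reflection x -> -x turns the integral into its own negative.\<close>

lemma gaussian_moment_odd:
  fixes \<alpha> :: complex
  assumes "odd k"
  shows "(LINT x|lborel. of_real x ^ k * exp (- \<alpha> * (of_real x)\<^sup>2)) = 0"
proof -
  have "(LINT x|lborel. of_real x ^ k * exp (- \<alpha> * (of_real x)\<^sup>2)) = - (LINT x|lborel. of_real x ^ k * exp (- \<alpha> * (of_real x)\<^sup>2))"
    using assms by (subst lborel_integral_real_affine[where c = "-1" and t = 0]) simp_all
  then show ?thesis by (simp add: eq_neg_iff_add_eq_0)
qed

section \<open>The Gaussian integral for complex \<alpha>\<close>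

text \<open>On a compact interval the integral may be differentiated under the integral sign.
  Integration by parts then cancels everything except the boundary term at \<open>R\<close>.\<close>

lemma truncated_gaussian_deriv:
  fixes \<alpha> :: complex and R :: real
  assumes "Re \<alpha> > 0" "R \<ge> 0"
  shows "((\<lambda>z. csqrt z * integral {-R..R} (\<lambda>x. exp (- z * (of_real x)\<^sup>2)))
    has_field_derivative of_real R * exp (- \<alpha> * (of_real R)\<^sup>2) / csqrt \<alpha>) (at \<alpha> within {z. Re z > 0})"
proof -
  let ?I = "integral {-R..R} (\<lambda>x. exp (- \<alpha> * (of_real x)\<^sup>2))"
  let ?J = "integral {-R..R} (\<lambda>x. - (of_real x)\<^sup>2 * exp (- \<alpha> * (of_real x)\<^sup>2))"
  have nz: "\<alpha> \<notin> \<real>\<^sub>\<le>\<^sub>0" "\<alpha> \<noteq> 0"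
    using assms by (auto elim!: nonpos_Reals_cases)
  have I: "((\<lambda>z. integral (cbox (-R) R) (\<lambda>x. exp (- z * (of_real x)\<^sup>2))) has_field_derivative
      integral (cbox (-R) R) (\<lambda>x. - (of_real x)\<^sup>2 * exp (- \<alpha> * (of_real x)\<^sup>2))) (at \<alpha> within {z. Re z > 0})"
  proof (rule leibniz_rule_field_derivative)
    show "((\<lambda>z. exp (- z * (of_real t)\<^sup>2)) has_field_derivative - (of_real t)\<^sup>2 * exp (- z * (of_real t)\<^sup>2))
      (at z within {z. Re z > 0})" for z and t :: real
      by (auto intro!: derivative_eq_intros)
    show "(\<lambda>x. exp (- z * (of_real x)\<^sup>2)) integrable_on cbox (-R) R" for z :: complex
      by (intro integrable_continuous continuous_intros)
    show "continuous_on ({z. Re z > 0} \<times> cbox (-R) R) (\<lambda>(z, t). - (of_real t)\<^sup>2 * exp (- z * (of_real t)\<^sup>2))"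
      unfolding case_prod_unfold by (intro continuous_intros)
  qed (use assms in \<open>auto simp: convex_halfspace_Re_gt\<close>)
  \<comment> \<open>The integrand is the derivative of x times the Gaussian; this yields the linear
    relation between \<open>?I\<close> and \<open>?J\<close>.\<close>
  have "((\<lambda>x. exp (- \<alpha> * (of_real x)\<^sup>2) + 2 * \<alpha> * (- (of_real x)\<^sup>2 * exp (- \<alpha> * (of_real x)\<^sup>2))) has_integral
      of_real R * exp (- \<alpha> * (of_real R)\<^sup>2) - of_real (-R) * exp (- \<alpha> * (of_real (-R))\<^sup>2)) {-R..R}"
  proof (rule fundamental_theorem_of_calculus)
    show "((\<lambda>x. of_real x * exp (- \<alpha> * (of_real x)\<^sup>2)) has_vector_derivative
        exp (- \<alpha> * (of_real x)\<^sup>2) + 2 * \<alpha> * (- (of_real x)\<^sup>2 * exp (- \<alpha> * (of_real x)\<^sup>2))) (at x within {-R..R})" for x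
    proof -
      have "((\<lambda>z. z * exp (- \<alpha> * z\<^sup>2)) has_field_derivative
        exp (- \<alpha> * (of_real x)\<^sup>2) + 2 * \<alpha> * (- (of_real x)\<^sup>2 * exp (- \<alpha> * (of_real x)\<^sup>2))) (at (of_real x))"
        by (auto intro!: derivative_eq_intros simp: algebra_simps power2_eq_square)
      from has_vector_derivative_real_field[OF this] show ?thesis
        by (rule has_vector_derivative_at_within)
    qed
  qed (use assms in auto)
  then have "integral {-R..R} (\<lambda>x. exp (- \<alpha> * (of_real x)\<^sup>2) + 2 * \<alpha> * (- (of_real x)\<^sup>2 * exp (- \<alpha> * (of_real x)\<^sup>2)))
      = 2 * of_real R * exp (- \<alpha> * (of_real R)\<^sup>2)"
    by (auto dest: integral_unique)
  moreover have "integral {-R..R} (\<lambda>x. exp (- \<alpha> * (of_real x)\<^sup>2) + 2 * \<alpha> * (- (of_real x)\<^sup>2 * exp (- \<alpha> * (of_real x)\<^sup>2)))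
      = ?I + 2 * \<alpha> * ?J"
    by (subst Henstock_Kurzweil_Integration.integral_add)
      (auto intro!: integrable_continuous_interval continuous_intros)
  ultimately have IJ: "?I + 2 * \<alpha> * ?J = 2 * of_real R * exp (- \<alpha> * (of_real R)\<^sup>2)"
    by simp
  \<comment> \<open>The left side is the product rule; writing \<alpha> as the square of
    \<open>csqrt \<alpha>\<close> exposes the combination evaluated in \<open>IJ\<close>.\<close>
  have "csqrt \<alpha> * ?J + ?I / (2 * csqrt \<alpha>) = (?I + 2 * (csqrt \<alpha>)\<^sup>2 * ?J) / (2 * csqrt \<alpha>)"
    using nz by (simp add: field_simps power2_eq_square del: power2_csqrt)
  also have "\<dots> = of_real R * exp (- \<alpha> * (of_real R)\<^sup>2) / csqrt \<alpha>"
    unfolding power2_csqrt IJ by simp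
  finally show ?thesis
    using I nz by (auto intro!: derivative_eq_intros simp: mult.commute)
qed

text \<open>Links the gauge integrals over growing intervals to the Lebesgue integral, by dominated
  convergence with the modulus of the Gaussian as majorant.\<close>

lemma tendsto_truncated_gaussian:
  fixes \<alpha> :: complex
  assumes "Re \<alpha> > 0"
  shows "(\<lambda>n. integral {-real n..real n} (\<lambda>x. exp (- \<alpha> * (of_real x)\<^sup>2)))
    \<longlonglongrightarrow> (LINT x|lborel. exp (- \<alpha> * (of_real x)\<^sup>2))"
proof -
  let ?g = "\<lambda>x::real. exp (- \<alpha> * (of_real x)\<^sup>2)"
  have int: "integrable lborel ?g"
    using integrable_power_times_gaussian[OF assms, of 0] by simp
  have "integral {-real n..real n} ?g = (LINT x|lborel. indicator {-real n..real n} x *\<^sub>R ?g x)" for n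
    using set_borel_integral_eq_integral(2)[of "{-real n..real n}" ?g] int
    by (simp add: set_lebesgue_integral_def set_integrable_def integrable_mult_indicator)
  moreover have "(\<lambda>n. LINT x|lborel. indicator {-real n..real n} x *\<^sub>R ?g x) \<longlonglongrightarrow> (LINT x|lborel. ?g x)"
  proof (rule integral_dominated_convergence)
    show "integrable lborel (\<lambda>x. norm (?g x))"
      using int by (rule integrable_norm)
    have "(\<lambda>n. indicator {-real n..real n} x *\<^sub>R ?g x) \<longlonglongrightarrow> ?g x" for x
    proof (rule tendsto_eventually)
      obtain N where "real N > \<bar>x\<bar>" using reals_Archimedean2 by blast
      then show "\<forall>\<^sub>F n in sequentially. indicator {-real n..real n} x *\<^sub>R ?g x = ?g x"
        by (intro eventually_sequentiallyI[of N]) (auto simp: indicator_def)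
    qed
    then show "AE x in lborel. (\<lambda>n. indicator {-real n..real n} x *\<^sub>R ?g x) \<longlonglongrightarrow> ?g x"
      by simp
  qed (auto simp: indicator_def)
  ultimately show ?thesis by simp
qed

lemma integral_gaussian_real:
  fixes a :: real
  assumes "a > 0"
  shows "(LINT x|lborel. exp (- a * x\<^sup>2)) = sqrt (pi / a)"
proof -
  define \<sigma> where "\<sigma> = sqrt (1 / (2 * a))"
  have \<sigma>: "\<sigma> > 0" "\<sigma>\<^sup>2 = 1 / (2 * a)"
    using assms by (auto simp: \<sigma>_def)
  have "exp (- a * x\<^sup>2) = sqrt (pi / a) * normal_density 0 \<sigma> x" for x
    using \<sigma> assms by (simp add: normal_density_def mult.commute)
  then show ?thesis
    using integral_normal_density[OF \<sigma>(1), of 0] by simp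
qed

text \<open>The derivative in \<open>\<alpha>\<close> of the truncated integral times \<open>csqrt \<alpha>\<close> vanishes as the truncation is
  removed, so that the product is constant on the right half-plane; this fixes the branch of the
  root.\<close>

lemma integral_gaussian:
  fixes \<alpha> :: complex
  assumes "Re \<alpha> > 0"
  shows "(LINT x|lborel. exp (- \<alpha> * (of_real x)\<^sup>2)) = csqrt (of_real pi / \<alpha>)"
proof -
  define a where "a = Re \<alpha>"
  define F where "F = (\<lambda>n z. csqrt z * integral {-real n..real n} (\<lambda>x. exp (- z * (of_real x)\<^sup>2)))"
  \<comment> \<open>This half-plane is convex and contains both \<alpha> and its real part
    \<open>a\<close>. On it the Gaussian at \<open>n\<close> is at most
    \<open>exp (- a * (real n)\<^sup>2)\<close> in modulus, and \<open>norm (csqrt z)\<close> is at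
    least \<open>sqrt a\<close>.\<close>
  define S where "S = {z. Re z \<ge> a}"
  let ?L = "\<lambda>z. csqrt z * (LINT x|lborel. exp (- z * (of_real x)\<^sup>2))"
  have a: "a > 0" using assms by (simp add: a_def)
  have lim: "(\<lambda>n. F n z) \<longlonglongrightarrow> ?L z" if "Re z > 0" for z
    unfolding F_def using that by (intro tendsto_mult tendsto_const tendsto_truncated_gaussian)
  \<comment> \<open>Mean value inequality on \<open>S\<close>; the bound on the derivative tends to
    0 as n grows.\<close>
  have bound: "norm (F n \<alpha> - F n (of_real a)) \<le> real n * exp (- a * (real n)\<^sup>2) / sqrt a * norm (\<alpha> - of_real a)" for n
  proof (rule field_differentiable_bound[where S = S])
    show "(F n has_field_derivative of_nat n * exp (- z * (of_nat n)\<^sup>2) / csqrt z) (at z within S)"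
      if "z \<in> S" for z
      using truncated_gaussian_deriv[of z "real n"] that a unfolding F_def S_def
      by (auto intro: DERIV_subset)
    show "norm (of_nat n * exp (- z * (of_nat n)\<^sup>2) / csqrt z) \<le> real n * exp (- a * (real n)\<^sup>2) / sqrt a"
      if "z \<in> S" for z
    proof -
      have z: "Re z \<ge> a" using that by (simp add: S_def)
      have "Re (z * (of_nat n)\<^sup>2) = Re z * (real n)\<^sup>2"
        by (simp add: power2_eq_square)
      moreover have "a \<le> norm z" using z complex_Re_le_cmod[of z] by linarith
      ultimately show ?thesis
        using z a by (simp add: norm_mult norm_divide)
          (intro frac_le mult_mono, auto intro!: mult_right_mono)
    qed
    show "convex S" unfolding S_def by (rule convex_halfspace_Re_ge)
  qed (auto simp: S_def a_def)
  have "(\<lambda>n. F n \<alpha> - F n (of_real a)) \<longlonglongrightarrow> 0"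
  proof (rule Lim_null_comparison)
    show "(\<lambda>n. real n * exp (- a * (real n)\<^sup>2) / sqrt a * norm (\<alpha> - of_real a)) \<longlonglongrightarrow> 0"
      using a by real_asymp
  qed (use bound in simp)
  moreover have "(\<lambda>n. F n \<alpha> - F n (of_real a)) \<longlonglongrightarrow> ?L \<alpha> - ?L (of_real a)"
    using a assms by (intro tendsto_diff lim) auto
  ultimately have "?L \<alpha> = ?L (of_real a)"
    using LIMSEQ_unique by fastforce
  \<comment> \<open>The constant is evaluated at the real point \<open>a\<close>.\<close>
  also have "(LINT x|lborel. exp (- complex_of_real a * (of_real x)\<^sup>2)) = of_real (sqrt (pi / a))"
    using integral_gaussian_real[OF a] integral_complex_of_real[of lborel "\<lambda>x. exp (- a * x\<^sup>2)"]
    by (simp add: exp_of_real[symmetric])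
  also have "csqrt (of_real a) * of_real (sqrt (pi / a)) = of_real (sqrt pi)"
    using a by (simp flip: of_real_mult real_sqrt_mult)
  finally have L: "?L \<alpha> = of_real (sqrt pi)" .
  have nz: "\<alpha> \<noteq> 0" using assms by auto
  have "csqrt (of_real pi / \<alpha>) = of_real (sqrt pi) / csqrt \<alpha>"
  proof (rule csqrt_unique)
    show "(of_real (sqrt pi) / csqrt \<alpha>)\<^sup>2 = of_real pi / \<alpha>"
      by (simp add: power_divide flip: of_real_power)
    \<comment> \<open>A positive real part survives taking the reciprocal, so the quotient is the
      principal root of pi / \<alpha> and not its negative.\<close>
    have "Re (csqrt \<alpha>) > 0"
      using assms by (simp add: add_nonneg_pos)
    then show "0 < Re (of_real (sqrt pi) / csqrt \<alpha>) \<or>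
        Re (of_real (sqrt pi) / csqrt \<alpha>) = 0 \<and> 0 \<le> Im (of_real (sqrt pi) / csqrt \<alpha>)"
      by (auto simp: Re_divide intro!: divide_pos_pos mult_pos_pos add_pos_nonneg simp del: csqrt.sel)
  qed
  then have "csqrt \<alpha> * csqrt (of_real pi / \<alpha>) = ?L \<alpha>"
    using L nz by simp
  then show ?thesis using nz by (metis mult_left_cancel csqrt_eq_0)
qed

text \<open>Iterating the recurrence from the Gaussian integral contributes a factor (2n+1) / (2
  \<alpha>) at each step.\<close>

lemma gaussian_moment_even:
  fixes \<alpha> :: complex
  assumes "Re \<alpha> > 0"
  shows "(LINT x|lborel. of_real x ^ (2 * n) * exp (- \<alpha> * (of_real x)\<^sup>2))
    = csqrt (of_real pi / \<alpha>) * (fact (2 * n) / (fact n * (4 * \<alpha>) ^ n))"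
proof (induction n)
  case 0
  show ?case using integral_gaussian[OF assms] by simp
next
  case (Suc n)
  have nz: "\<alpha> \<noteq> 0" using assms by auto
  have "(LINT x|lborel. of_real x ^ (2 * n + 2) * exp (- \<alpha> * (of_real x)\<^sup>2)) =
    of_nat (2 * n + 1) * (LINT x|lborel. of_real x ^ (2 * n) * exp (- \<alpha> * (of_real x)\<^sup>2)) / (2 * \<alpha>)"
    using gaussian_moment_step[OF assms, of "2 * n"] nz by (simp add: field_simps del: power_add)
  also have "\<dots> = csqrt (of_real pi / \<alpha>) * (of_nat (2 * n + 1) * fact (2 * n) / (2 * \<alpha> * (fact n * (4 * \<alpha>) ^ n)))"
    unfolding Suc.IH by (simp add: field_simps)
  also have "of_nat (2 * n + 1) * fact (2 * n) / (2 * \<alpha> * (fact n * (4 * \<alpha>) ^ n))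
      = fact (2 * Suc n) / (fact (Suc n) * (4 * \<alpha>) ^ Suc n)"
  proof -
    \<comment> \<open>Numerator and denominator are both extended by 2(n+1) to complete the two
      factorials.\<close>
    have "fact (2 * Suc n) = (2 * of_nat (Suc n)) * (of_nat (2 * n + 1) * fact (2 * n) :: complex)"
      by (simp add: algebra_simps)
    moreover have "fact (Suc n) * (4 * \<alpha>) ^ Suc n
        = (2 * of_nat (Suc n)) * (2 * \<alpha> * (fact n * (4 * \<alpha>) ^ n))"
      by (simp add: algebra_simps)
    moreover have "2 * of_nat (Suc n) \<noteq> (0::complex)"
      by (simp del: of_nat_Suc)
    ultimately show ?thesis by (metis mult_divide_mult_cancel_left)
  qed
  finally show ?case by simp
qed


section \<open>Growth of the hypergeometric coefficients\<close>

text \<open>The factor \<open>of_nat (r + 1)\<close> stems from the factorial and acts like an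
  additional lower parameter 1; this is why the critical case is p = q + 1.\<close>

definition coeff_ratio :: "complex list \<Rightarrow> complex list \<Rightarrow> nat \<Rightarrow> complex" where
  "coeff_ratio as bs r = (\<Prod>a\<leftarrow>as. a + of_nat r) / ((\<Prod>b\<leftarrow>bs. b + of_nat r) * of_nat (r + 1))"

lemma prod_list_map_mult:
  fixes f g :: "'a \<Rightarrow> 'b::comm_monoid_mult"
  shows "(\<Prod>x\<leftarrow>xs. f x * g x) = (\<Prod>x\<leftarrow>xs. f x) * (\<Prod>x\<leftarrow>xs. g x)"
  by (induction xs) (simp_all add: mult_ac)

lemma pFq_term_0: "pFq_term as bs x 0 = 1"
proof -
  have "(\<Prod>c\<leftarrow>cs. 1) = (1 :: complex)" for cs :: "complex list"
    by (induction cs) simp_all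
  then show ?thesis by (simp add: pFq_term_def)
qed

text \<open>If a lower factor vanishes, division by zero makes both sides 0, so the recurrence has
  no exceptions.\<close>

lemma pFq_term_Suc: "pFq_term as bs x (Suc r) = pFq_term as bs x r * (coeff_ratio as bs r * x)"
  by (simp add: pFq_term_def coeff_ratio_def pochhammer_Suc prod_list_map_mult mult_ac divide_simps)

lemma pFq_term_mult: "pFq_term as bs (x * y) r = pFq_term as bs x r * y ^ r"
  by (simp add: pFq_term_def power_mult_distrib)

lemma tendsto_shifted_prod:
  "(\<lambda>r. (\<Prod>c\<leftarrow>cs. c + of_nat r) / of_nat (r + 1) ^ length cs) \<longlonglongrightarrow> (1 :: complex)"
proof (induction cs)
  case (Cons c cs)
  have "(\<lambda>r. 1 + (c - 1) * of_real (1 / real (r + 1))) \<longlonglongrightarrow> 1 + (c - 1) * of_real 0"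
    by (intro tendsto_intros) real_asymp
  moreover have "1 + (c - 1) * of_real (1 / real (r + 1)) = (c + of_nat r) / of_nat (r + 1)" for r
    using of_nat_neq_0[of r, where 'a = complex] by (simp add: field_simps)
  ultimately have "(\<lambda>r. (c + of_nat r) / of_nat (r + 1)) \<longlonglongrightarrow> (1 :: complex)"
    by simp
  from tendsto_mult[OF this Cons.IH] show ?case by simp
qed simp

text \<open>Counting degrees in r: the ratio behaves like (r+1)^(p-q-1), hence is O(1/r) for p \<le>
  q and tends to 1 for p = q + 1.\<close>

lemma tendsto_coeff_ratio:
  assumes "length as \<le> Suc (length bs)"
  shows "(\<lambda>r. coeff_ratio as bs r * of_nat (r + 1) ^ (Suc (length bs) - length as)) \<longlonglongrightarrow> 1"
proof -
  have "(\<lambda>r. ((\<Prod>a\<leftarrow>as. a + of_nat r) / of_nat (r + 1) ^ length as) /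
      ((\<Prod>b\<leftarrow>bs. b + of_nat r) / of_nat (r + 1) ^ length bs)) \<longlonglongrightarrow> (1 / 1 :: complex)"
    by (intro tendsto_divide tendsto_shifted_prod) simp
  moreover have "((\<Prod>a\<leftarrow>as. a + of_nat r) / of_nat (r + 1) ^ length as) /
      ((\<Prod>b\<leftarrow>bs. b + of_nat r) / of_nat (r + 1) ^ length bs)
     = coeff_ratio as bs r * of_nat (r + 1) ^ (Suc (length bs) - length as)" for r
    using assms of_nat_neq_0[of r, where 'a = complex]
    by (simp add: coeff_ratio_def power_diff divide_simps)
  ultimately show ?thesis by simp
qed

text \<open>A convergent sequence is bounded, so each ratio is at most M / (r+1); multiplying these
  bounds produces the factorial.\<close>

lemma norm_pFq_term_le:
  assumes "length as \<le> length bs"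
  obtains D where "D \<ge> 0" "\<And>r. norm (pFq_term as bs x r) \<le> D ^ r / fact r"
proof -
  define d where "d = length bs - length as"
  have "Suc (length bs) - length as = Suc d"
    using assms by (simp add: d_def)
  then have "convergent (\<lambda>r. coeff_ratio as bs r * of_nat (r + 1) ^ Suc d)"
    using tendsto_coeff_ratio[of as bs] assms unfolding convergent_def by auto
  then obtain M where M: "M > 0" "\<And>r. norm (coeff_ratio as bs r * of_nat (r + 1) ^ Suc d) \<le> M"
    by (elim convergent_imp_Bseq[THEN BseqE]) blast
  have ratio: "norm (coeff_ratio as bs r) \<le> M / real (r + 1)" for r
  proof -
    \<comment> \<open>The surplus powers of r + 1 are at least 1 and can be discarded.\<close>
    have "norm (coeff_ratio as bs r) * real (r + 1) \<le> norm (coeff_ratio as bs r) * real (r + 1) ^ Suc d"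
      by (intro mult_left_mono self_le_power) auto
    also have "\<dots> \<le> M"
      using M(2)[of r] by (simp add: norm_mult norm_power del: power_Suc of_nat_add of_nat_Suc)
    finally show ?thesis by (simp add: field_simps)
  qed
  have "norm (pFq_term as bs x r) \<le> (M * norm x) ^ r / fact r" for r
  proof (induction r)
    case (Suc r)
    have "norm (pFq_term as bs x (Suc r)) = norm (pFq_term as bs x r) * (norm (coeff_ratio as bs r) * norm x)"
      by (simp add: pFq_term_Suc norm_mult)
    also have "\<dots> \<le> (M * norm x) ^ r / fact r * (M / real (r + 1) * norm x)"
      using M by (intro mult_mono Suc.IH ratio) auto
    also have "\<dots> = (M * norm x) ^ Suc r / fact (Suc r)"
      by (simp add: divide_simps)
    finally show ?case .
  qed (simp add: pFq_term_0)
  then show thesis using M by (intro that[of "M * norm x"]) auto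
qed

text \<open>Since the ratio tends to 1, a series without zero terms diverges outside the unit disc.
  So some term is 0, and the recurrence propagates the zero.\<close>

lemma pFq_term_eventually_zero:
  assumes len: "length as = Suc (length bs)"
    and conv: "\<And>t::real. summable (pFq_term as bs (x * of_real t))"
  obtains N where "\<And>r. r \<ge> N \<Longrightarrow> pFq_term as bs x r = 0"
proof -
  have "\<exists>N. pFq_term as bs x N = 0"
  proof (rule ccontr)
    assume "\<not> ?thesis"
    then have nz: "pFq_term as bs x r \<noteq> 0" for r by blast
    have "x \<noteq> 0"
      using nz[of 1] by (auto simp: pFq_term_def)
    \<comment> \<open>This scaling gives the argument modulus 2, so that ratios exceeding 1/2
      already keep the terms from decreasing.\<close>
    define t where "t = 2 / norm x"
    define y where "y = x * of_real t"
    have y: "norm y = 2"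
      using \<open>x \<noteq> 0\<close> by (simp add: y_def t_def norm_mult norm_divide)
    have nzy: "pFq_term as bs y r \<noteq> 0" for r
      using nz[of r] \<open>x \<noteq> 0\<close> unfolding y_def pFq_term_mult by (simp add: t_def)
    have "(\<lambda>r. norm (coeff_ratio as bs r)) \<longlonglongrightarrow> norm (1 :: complex)"
      using tendsto_coeff_ratio[of as bs] len by (intro tendsto_norm) simp
    then have "\<forall>\<^sub>F r in sequentially. norm (coeff_ratio as bs r) > 1 / 2"
      by (rule order_tendstoD) simp
    then obtain N where N: "\<And>r. r \<ge> N \<Longrightarrow> norm (coeff_ratio as bs r) > 1 / 2"
      by (auto simp: eventually_sequentially)
    have mono: "norm (pFq_term as bs y N) \<le> norm (pFq_term as bs y r)" if "r \<ge> N" for r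
      using that
    proof (induction r rule: dec_induct)
      case (step r)
      have "norm (pFq_term as bs y r) * 1 \<le> norm (pFq_term as bs y r) * (norm (coeff_ratio as bs r) * norm y)"
        using N[of r] step.hyps y by (intro mult_left_mono) auto
      then show ?case
        using step.IH by (simp add: pFq_term_Suc norm_mult)
    qed simp
    have "pFq_term as bs y \<longlonglongrightarrow> 0"
      using conv[of t] by (simp add: y_def summable_LIMSEQ_zero)
    then have "(\<lambda>r. norm (pFq_term as bs y r)) \<longlonglongrightarrow> 0"
      by (rule tendsto_norm_zero)
    then have "norm (pFq_term as bs y N) \<le> 0"
      by (rule LIMSEQ_le_const) (use mono in blast)
    with nzy show False by simp
  qed
  then obtain N where N: "pFq_term as bs x N = 0" by blast
  have "pFq_term as bs x r = 0" if "r \<ge> N" for r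
    using that by (induction r rule: dec_induct) (simp_all add: N pFq_term_Suc)
  then show thesis by (rule that)
qed

lemma pFq_term_exponential_bound:
  assumes len: "length as \<le> Suc (length bs)"
    and conv: "length as = Suc (length bs) \<Longrightarrow> \<forall>t::real. summable (pFq_term as bs (x * of_real t))"
  obtains K D where "K \<ge> 0" "D \<ge> 0" "\<And>r. norm (pFq_term as bs x r) \<le> K * D ^ r / fact r"
proof (cases "length as = Suc (length bs)")
  case True
  obtain N where N: "\<And>r. r \<ge> N \<Longrightarrow> pFq_term as bs x r = 0"
    using pFq_term_eventually_zero[OF True] conv[OF True] by blast
  \<comment> \<open>Only finitely many terms are nonzero, so \<open>D\<close> = 1 works and the sum
    majorises each of them times its factorial.\<close>
  define K where "K = (\<Sum>r<N. norm (pFq_term as bs x r) * fact r)"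
  have K: "K \<ge> 0" unfolding K_def by (intro sum_nonneg) simp
  have "norm (pFq_term as bs x r) * fact r \<le> K" for r
  proof (cases "r < N")
    case True
    then show ?thesis unfolding K_def
      by (intro member_le_sum[where f = "\<lambda>r. norm (pFq_term as bs x r) * fact r"]) auto
  qed (use K N[of r] in simp)
  then have "norm (pFq_term as bs x r) \<le> K * 1 ^ r / fact r" for r
    by (simp add: pos_le_divide_eq)
  then show thesis using K by (intro that[of K 1]) auto
next
  case False
  then have "length as \<le> length bs" using len by simp
  then obtain D where "D \<ge> 0" "\<And>r. norm (pFq_term as bs x r) \<le> D ^ r / fact r"
    using norm_pFq_term_le by blast
  then show thesis by (intro that[of 1 D]) auto
qed

section \<open>Duplication formula and halved parameters\<close>

text \<open>Each parameter is split by the duplication formula, which costs one factor 4^n.\<close>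

lemma prod_list_pochhammer_double:
  "(\<Prod>c\<leftarrow>cs. pochhammer c (2 * n)) = 4 ^ (n * length cs) * (\<Prod>c\<leftarrow>halved_params cs. pochhammer c n)"
proof (induction cs)
  case (Cons c cs)
  have "pochhammer c (2 * n) = 4 ^ n * (pochhammer (c / 2) n * pochhammer ((c + 1) / 2) n)"
  proof -
    have "of_nat (2 ^ (2 * n)) = (4 ^ n :: complex)"
      by (simp add: power_mult)
    then have "pochhammer (2 * (c / 2)) (2 * n) = 4 ^ n * pochhammer (c / 2) n * pochhammer (c / 2 + 1 / 2) n"
      by (simp only: pochhammer_double)
    then show ?thesis
      by (simp add: add_divide_distrib mult.assoc)
  qed
  then show ?case
    using Cons.IH by (simp add: halved_params_def power_add mult_ac)
qed (simp add: halved_params_def)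

text \<open>The powers of 4 from duplication merge into the argument as 2^(2(p-q)). The
  \<open>fact (2 * n)\<close> of the moment cancels the one in the even term, leaving
  \<open>fact n\<close>.\<close>

lemma pFq_term_halved_params:
  "pFq_term as bs \<beta> (2 * n) * (fact (2 * n) / (fact n * (4 * \<alpha>) ^ n))
    = pFq_term (halved_params as) (halved_params bs)
        (2 powi (2 * (int (length as) - int (length bs))) * (\<beta>\<^sup>2 / (4 * \<alpha>))) n"
proof -
  have powi: "(2 powi (2 * (int (length as) - int (length bs))) :: complex) = 4 ^ length as / 4 ^ length bs"
    by (simp add: power_int_mult power_int_diff)
  have power: "(4 ^ length as / 4 ^ length bs * (\<beta>\<^sup>2 / (4 * \<alpha>))) ^ n
      = 4 ^ (n * length as) / 4 ^ (n * length bs) * (\<beta> ^ (2 * n) / (4 * \<alpha>) ^ n)"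
    by (simp add: power_mult_distrib power_divide flip: power_mult) (simp add: mult.commute)
  show ?thesis
    unfolding pFq_term_def prod_list_pochhammer_double powi power by (simp add: mult_ac)
qed

section \<open>Term-by-term integration against the Gaussian\<close>

text \<open>Completing the square: half of the Gaussian decay absorbs the exponential at the price
  of a constant factor.\<close>

lemma integrable_gaussian_exp_abs:
  fixes a D :: real
  assumes "a > 0"
  shows "integrable lborel (\<lambda>x. exp (- a * x\<^sup>2) * exp (D * \<bar>x\<bar>))"
proof (rule Bochner_Integration.integrable_bound)
  show "integrable lborel (\<lambda>x. exp (D\<^sup>2 / (2 * a)) * exp (- (a / 2) * x\<^sup>2))"
    using integrable_power_times_gaussian_real[of "a / 2" 0] assms by simp
  have "- a * x\<^sup>2 + D * \<bar>x\<bar> \<le> D\<^sup>2 / (2 * a) + - (a / 2) * x\<^sup>2" for x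
  proof -
    have "0 \<le> (a * \<bar>x\<bar> - D)\<^sup>2 / (2 * a)" using assms by simp
    also have "\<dots> = D\<^sup>2 / (2 * a) + (a / 2) * x\<^sup>2 - D * \<bar>x\<bar>"
      using assms by (simp add: power2_diff field_simps power2_eq_square)
    finally show ?thesis by (simp add: field_simps)
  qed
  then show "AE x in lborel. norm (exp (- a * x\<^sup>2) * exp (D * \<bar>x\<bar>)) \<le> norm (exp (D\<^sup>2 / (2 * a)) * exp (- (a / 2) * x\<^sup>2))"
    by (simp flip: exp_add)
qed simp

text \<open>The three facts share one majorant: the exponential series bounds all partial sums
  uniformly by \<open>K * exp (D * \<bar>x\<bar>)\<close>, which remains integrable against the
  Gaussian.\<close>

lemma
  fixes c :: "nat \<Rightarrow> complex" and \<alpha> :: complex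
  assumes alpha: "Re \<alpha> > 0"
    and KD: "K \<ge> 0" "D \<ge> 0" "\<And>r. norm (c r) \<le> K * D ^ r / fact r"
  shows summable_of_gaussian_bound: "summable (\<lambda>r. c r * of_real x ^ r)"
    and integrable_gaussian_power_series:
      "integrable lborel (\<lambda>x. exp (- \<alpha> * (of_real x)\<^sup>2) * (\<Sum>r. c r * of_real x ^ r))"
    and sums_gaussian_power_series:
      "(\<lambda>r. c r * (LINT x|lborel. of_real x ^ r * exp (- \<alpha> * (of_real x)\<^sup>2)))
        sums (LINT x|lborel. exp (- \<alpha> * (of_real x)\<^sup>2) * (\<Sum>r. c r * of_real x ^ r))"
proof -
  let ?g = "\<lambda>x::real. exp (- \<alpha> * (of_real x)\<^sup>2)"
  let ?s = "\<lambda>n x. \<Sum>r<n. c r * (of_real x ^ r * ?g x)"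
  let ?w = "\<lambda>x. K * (exp (- Re \<alpha> * x\<^sup>2) * exp (D * \<bar>x\<bar>))"
  have exp_sums: "(\<lambda>r. K * ((D * \<bar>x\<bar>) ^ r / fact r)) sums (K * exp (D * \<bar>x\<bar>))" for x
    using exp_converges[of "D * \<bar>x\<bar>"] by (intro sums_mult) (simp add: scaleR_conv_of_real divide_inverse mult.commute)
  have term_le: "norm (c r * of_real x ^ r) \<le> K * ((D * \<bar>x\<bar>) ^ r / fact r)" for r x
    using mult_right_mono[OF KD(3)[of r], of "\<bar>x\<bar> ^ r"]
    by (simp add: norm_mult norm_power power_mult_distrib mult_ac)
  show summ: "summable (\<lambda>r. c r * of_real x ^ r)" for x
    by (rule summable_comparison_test'[OF sums_summable[OF exp_sums] term_le])
  note int = integrable_power_times_gaussian[OF alpha]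
  have int_s: "integrable lborel (?s n)" for n
    by (intro Bochner_Integration.integrable_sum integrable_mult_right int)
  have lim: "(\<lambda>n. ?s n x) \<longlonglongrightarrow> ?g x * (\<Sum>r. c r * of_real x ^ r)" for x
  proof -
    have "(\<lambda>n. ?g x * (\<Sum>r<n. c r * of_real x ^ r)) \<longlonglongrightarrow> ?g x * (\<Sum>r. c r * of_real x ^ r)"
      using summable_sums[OF summ[of x]] unfolding sums_def by (intro tendsto_mult tendsto_const)
    then show ?thesis by (simp only: sum_distrib_left mult_ac)
  qed
  have bound: "norm (?s n x) \<le> ?w x" for n x
  proof -
    have "norm (?s n x) = norm (?g x) * norm (\<Sum>r<n. c r * of_real x ^ r)"
      by (simp only: norm_mult[symmetric] sum_distrib_left mult_ac)
    also have "norm (\<Sum>r<n. c r * of_real x ^ r) \<le> (\<Sum>r<n. K * ((D * \<bar>x\<bar>) ^ r / fact r))"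
      by (intro sum_norm_le term_le)
    also have "\<dots> \<le> K * exp (D * \<bar>x\<bar>)"
      using KD by (intro order_trans[OF sum_le_suminf[OF sums_summable[OF exp_sums]] eq_refl[OF sums_unique[OF exp_sums, symmetric]]]) auto
    finally show ?thesis
      by (simp add: Re_power2 mult_ac mult_left_mono)
  qed
  \<comment> \<open>The infinite sum is measurable as a pointwise limit of integrable partial
    sums.\<close>
  have meas: "(\<lambda>x. ?g x * (\<Sum>r. c r * of_real x ^ r)) \<in> borel_measurable lborel"
    by (rule borel_measurable_LIMSEQ_metric[OF borel_measurable_integrable[OF int_s]]) (rule lim)
  have dom: "integrable lborel ?w"
    using alpha by (intro integrable_mult_right integrable_gaussian_exp_abs)
  show "integrable lborel (\<lambda>x. ?g x * (\<Sum>r. c r * of_real x ^ r))"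
    using lim bound by (intro integrable_dominated_convergence[OF meas borel_measurable_integrable[OF int_s] dom] AE_I2)
  have "(\<lambda>n. integral\<^sup>L lborel (?s n)) \<longlonglongrightarrow> (LINT x|lborel. ?g x * (\<Sum>r. c r * of_real x ^ r))"
    using lim bound by (intro integral_dominated_convergence[OF meas borel_measurable_integrable[OF int_s] dom] AE_I2)
  moreover have "integral\<^sup>L lborel (?s n) = (\<Sum>r<n. c r * (LINT x|lborel. of_real x ^ r * ?g x))" for n
    unfolding Bochner_Integration.integral_sum[OF integrable_mult_right[OF int]]
    by (simp only: integral_mult_right_zero)
  ultimately show "(\<lambda>r. c r * (LINT x|lborel. of_real x ^ r * ?g x))
      sums (LINT x|lborel. ?g x * (\<Sum>r. c r * of_real x ^ r))"
    by (simp add: sums_def)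
qed

section \<open>Assembly of the integral formula\<close>

theorem theorem2:
  fixes as bs :: "complex list" and \<alpha> \<beta> :: complex and p q :: nat
  assumes p: "length as = p" and q: "length bs = q"
    and pq: "p \<le> q + 1"
    and bs: "\<And>b. b \<in> set bs \<Longrightarrow> b \<notin> \<int>\<^sub>\<le>\<^sub>0"
    and alpha: "Re \<alpha> > 0"
    and conv: "p = q + 1 \<Longrightarrow> \<forall>x::real. summable (pFq_term as bs (\<beta> * of_real x))"
  shows "(\<forall>x::real. summable (pFq_term as bs (\<beta> * of_real x)))
    \<and> summable (pFq_term (halved_params as) (halved_params bs)
          (2 powi (2 * (int p - int q)) * (\<beta>\<^sup>2 / (4 * \<alpha>))))
    \<and> integrable lborel (\<lambda>x::real. exp (- \<alpha> * (of_real x)\<^sup>2) * pFq as bs (\<beta> * of_real x))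
    \<and> (LINT x|lborel. exp (- \<alpha> * (of_real x)\<^sup>2) * pFq as bs (\<beta> * of_real x))
        = csqrt (of_real pi / \<alpha>)
          * pFq (halved_params as) (halved_params bs)
              (2 powi (2 * (int p - int q)) * (\<beta>\<^sup>2 / (4 * \<alpha>)))"
proof -
  define c where "c = pFq_term as bs \<beta>"
  define z where "z = 2 powi (2 * (int p - int q)) * (\<beta>\<^sup>2 / (4 * \<alpha>))"
  define h where "h = pFq_term (halved_params as) (halved_params bs) z"
  define M where "M = (\<lambda>r. LINT x|lborel. of_real x ^ r * exp (- \<alpha> * (of_real x)\<^sup>2))"
  define I where "I = (LINT x|lborel. exp (- \<alpha> * (of_real x)\<^sup>2) * pFq as bs (\<beta> * of_real x))"
  define s where "s = csqrt (of_real pi / \<alpha>)"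
  obtain K D where KD: "K \<ge> 0" "D \<ge> 0" "\<And>r. norm (c r) \<le> K * D ^ r / fact r"
    using pFq_term_exponential_bound[of as bs \<beta>] p q pq conv unfolding c_def by auto
  have c_eq: "pFq_term as bs (\<beta> * of_real x) = (\<lambda>r. c r * of_real x ^ r)" for x
    by (simp add: c_def pFq_term_mult fun_eq_iff)
  have pFq_eq: "pFq as bs (\<beta> * of_real x) = (\<Sum>r. c r * of_real x ^ r)" for x
    by (simp add: pFq_def c_eq)
  have "s \<noteq> 0" using alpha by (auto simp: s_def)
  have odd_zero: "c r * M r = 0" if "r \<notin> range (\<lambda>n. 2 * n)" for r
  proof -
    have "odd r" using that by (auto elim!: evenE)
    from gaussian_moment_odd[OF this] show ?thesis by (simp only: M_def mult_zero_right)
  qed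
  \<comment> \<open>Reindexing along n -> 2n skips only zero terms, so convergence and sum are the
    same for both series.\<close>
  have "strict_mono (\<lambda>n::nat. 2 * n)"
    by (simp add: strict_mono_def)
  from sums_mono_reindex[OF this odd_zero]
  have "(\<lambda>n. c (2 * n) * M (2 * n)) sums I \<longleftrightarrow> (\<lambda>r. c r * M r) sums I" .
  moreover have "(\<lambda>r. c r * M r) sums I"
    using sums_gaussian_power_series[OF alpha KD] by (simp only: M_def I_def pFq_eq)
  moreover have "c (2 * n) * M (2 * n) = s * h n" for n
    using pFq_term_halved_params[of as bs \<beta> n \<alpha>]
    unfolding c_def M_def s_def h_def z_def gaussian_moment_even[OF alpha] p q
    by (simp only: mult.left_commute[of "pFq_term as bs \<beta> (2 * n)"])
  ultimately have "(\<lambda>n. s * h n) sums I" by simp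
  \<comment> \<open>Dividing by the nonzero root gives the convergence of the transformed series
    together with its value, so no separate convergence test is required.\<close>
  then have "(\<lambda>n. s * h n / s) sums (I / s)"
    by (rule sums_divide)
  then have "h sums (I / s)"
    using \<open>s \<noteq> 0\<close> by simp
  then have "summable h" "I = s * (\<Sum>n. h n)"
    using \<open>s \<noteq> 0\<close> by (auto simp: sums_iff)
  moreover have "\<forall>x::real. summable (pFq_term as bs (\<beta> * of_real x))"
    using summable_of_gaussian_bound[OF alpha KD] by (simp add: c_eq)
  moreover have "integrable lborel (\<lambda>x. exp (- \<alpha> * (of_real x)\<^sup>2) * pFq as bs (\<beta> * of_real x))"
    using integrable_gaussian_power_series[OF alpha KD] by (simp only: pFq_eq)
  ultimately show ?thesis
    by (simp add: h_def z_def I_def s_def pFq_def)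
qed

end
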